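(* Let $a,b,c,d,e,m$ be nonnegative integers and let $\pi=\Lambda(a,b,c,d,e,m)=\lambda/b^a$ be the skew shape defined in the context, with $n=|\pi|$. Then the number of standard Young tableaux of shape $\pi$ is \[ f^{\pi}=n!\cdot\frac{\Phi(a+b+c)\,\Phi(a)\,\Phi(b)\,\Phi(c)}{\Phi(a+b)\,\Phi(b+c)\,\Phi(a+c)\,\Psi^{(m)}(a+c)\,\Psi^{(m)}(b+c)}\;\prod_{i=0}^{a+c-1}\frac{(i(m+1))!}{(d+i(m+1))!}\;\prod_{i=0}^{b+c-1}\frac{(i(m+1))!}{(e+i(m+1))!}\;\frac{\prod_{i=0}^{b-1}\prod_{j=0}^{a-1}\bigl(1+d+e+(c+i+j)(m+1)\bigr)}{\prod_{i=0}^{b+c-1}\prod_{j=0}^{a+c-1}\bigl(1+d+e+(i+j)(m+1)\bigr)}. \]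
   Context: Young diagrams are in English notation, cells $(i,j)$ with row $i$ and column $j$. For a skew shape $\lambda/\mu$, $f^{\lambda/\mu}$ is the number of standard Young tableaux of shape $\lambda/\mu$. Superfactorial: $\Phi(n)=\prod_{k=1}^{n-1}k!$ (so $\Phi(0)=\Phi(1)=1$). Falling factorial $(k)_m=k(k-1)\cdots(k-m+1)$, $(k)_0=1$, and $\Psi^{(m)}(n)=\prod_{i=1}^{n-1}\prod_{j=1}^{i}(jm+j-1)_m$. The shape $\Lambda(a,b,c,d,e,m)$: set $\nu_i=d+(a+c-i)m$ for $1\le i\le a+c$ and $\theta_j=e+(b+c-j)m$ for $1\le j\le b+c$; let $\lambda$ be the partition whose Young diagram consists of the cells $(i,j)$ with either ($i\le a+c$ and $j\le b+c+\nu_i$) or ($j\le b+c$ and $i\le a+c+\theta_j$) (i.e. the $(a+c)\times(b+c)$ rectangle with the rows of $\nu$ attached to its right and the columns of lengths $\theta_j$ attached below it); then $\Lambda(a,b,c,d,e,m)=\lambda/b^a$ where $b^a=(b,\dots,b)$ ($a$ parts). For example $\Lambda(a,b,c,d,e,0)=(b+c+d)^{a+c}(b+c)^e/b^a$ and $\Lambda(a,b,c,0,0,1)=\delta_{a+b+2c}/b^a$ with $\delta_N=(N-1,N-2,\dots,1)$. *)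

theory Defs
  imports Complex_Main "HOL-Library.FuncSet"
begin

text \<open>
  A cell is a pair \<open>(i, j)\<close> of a row index and a column index, both starting at 1 (English
  notation). A Young diagram, or a skew shape \<open>\<lambda>/\<mu>\<close>, is represented by its set of cells.
\<close>

type_synonym cell = "nat \<times> nat"

definition is_syt :: "cell set \<Rightarrow> (cell \<Rightarrow> nat) \<Rightarrow> bool" where
  "is_syt S T \<longleftrightarrow>
     bij_betw T S {1..card S} \<and>
     (\<forall>i j j'. (i, j) \<in> S \<longrightarrow> (i, j') \<in> S \<longrightarrow> j < j' \<longrightarrow> T (i, j) < T (i, j')) \<and>
     (\<forall>i i' j. (i, j) \<in> S \<longrightarrow> (i', j) \<in> S \<longrightarrow> i < i' \<longrightarrow> T (i, j) < T (i', j))"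

text \<open>
  Fillings are made \<^const>\<open>extensional\<close> so that each tableau is represented by exactly one
  function.
\<close>

definition num_syt :: "cell set \<Rightarrow> nat" where
  "num_syt S = card {T \<in> extensional S. is_syt S T}"

definition superfact :: "nat \<Rightarrow> nat" where
  "superfact n = (\<Prod>k\<in>{1..<n}. fact k)"

text \<open>
  The truncated subtraction is harmless: if \<open>k < m\<close>, the factor for \<open>i = k\<close> is zero.
\<close>

definition falling_fact :: "nat \<Rightarrow> nat \<Rightarrow> nat" where
  "falling_fact k m = (\<Prod>i<m. k - i)"

definition Psi :: "nat \<Rightarrow> nat \<Rightarrow> nat" where
  "Psi m n = (\<Prod>i\<in>{1..<n}. \<Prod>j\<in>{1..i}. falling_fact (j * m + j - 1) m)"

definition nu :: "nat \<Rightarrow> nat \<Rightarrow> nat \<Rightarrow> nat \<Rightarrow> nat \<Rightarrow> nat" where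
  "nu a c d m i = d + (a + c - i) * m"

definition theta :: "nat \<Rightarrow> nat \<Rightarrow> nat \<Rightarrow> nat \<Rightarrow> nat \<Rightarrow> nat" where
  "theta b c e m j = e + (b + c - j) * m"

definition outer_shape :: "nat \<Rightarrow> nat \<Rightarrow> nat \<Rightarrow> nat \<Rightarrow> nat \<Rightarrow> nat \<Rightarrow> cell set" where
  "outer_shape a b c d e m =
     {(i, j). 1 \<le> i \<and> 1 \<le> j \<and>
        (i \<le> a + c \<and> j \<le> b + c + nu a c d m i \<or>
         j \<le> b + c \<and> i \<le> a + c + theta b c e m j)}"

definition rect_shape :: "nat \<Rightarrow> nat \<Rightarrow> cell set" where
  "rect_shape a b = {1..a} \<times> {1..b}"

definition Lambda_shape :: "nat \<Rightarrow> nat \<Rightarrow> nat \<Rightarrow> nat \<Rightarrow> nat \<Rightarrow> nat \<Rightarrow> cell set" where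
  "Lambda_shape a b c d e m = outer_shape a b c d e m - rect_shape a b"

lemma outer_shape_down_closed:
  assumes "(i, j) \<in> outer_shape a b c d e m" "1 \<le> i'" "i' \<le> i" "1 \<le> j'" "j' \<le> j"
  shows "(i', j') \<in> outer_shape a b c d e m"
proof -
  have 1: "nu a c d m i \<le> nu a c d m i'" and 2: "theta b c e m j \<le> theta b c e m j'"
    using assms by (auto simp: nu_def theta_def intro!: mult_le_mono1 diff_le_mono2)
  show ?thesis using assms 1 2 unfolding outer_shape_def by auto
qed

lemma rect_shape_subset_outer_shape: "rect_shape a b \<subseteq> outer_shape a b c d e m"
  by (auto simp: rect_shape_def outer_shape_def)

lemma finite_outer_shape: "finite (outer_shape a b c d e m)"
proof (rule finite_subset)
  let ?N = "a + b + c + d + e + (a + b + c) * m"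
  have *: "(a + c - i) * m \<le> (a + b + c) * m" "(b + c - i) * m \<le> (a + b + c) * m" for i
    by (intro mult_le_mono1; simp)+
  show "outer_shape a b c d e m \<subseteq> {..?N} \<times> {..?N}"
  proof (clarsimp simp: outer_shape_def nu_def theta_def)
    fix i j
    assume "i \<le> a + c \<and> j \<le> b + c + (d + (a + c - i) * m) \<or>
            j \<le> b + c \<and> i \<le> a + c + (e + (b + c - j) * m)"
    then show "i \<le> ?N \<and> j \<le> ?N"
      using *(1)[of i] *(2)[of j] by linarith
  qed
qed simp

lemma Lambda_shape_m0:
  "Lambda_shape a b c d e 0 =
     (rect_shape (a + c) (b + c + d) \<union> rect_shape (a + c + e) (b + c)) - rect_shape a b"
  by (auto simp: Lambda_shape_def outer_shape_def rect_shape_def nu_def theta_def)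

lemma Lambda_shape_staircase:
  "Lambda_shape a b c 0 0 1 = {(i, j). 1 \<le> i \<and> 1 \<le> j \<and> i + j \<le> a + b + 2 * c} - rect_shape a b"
  by (auto simp: Lambda_shape_def outer_shape_def rect_shape_def nu_def theta_def)

end

theory Submission
  imports Defs "Jordan_Normal_Form.Determinant" "HOL-Computational_Algebra.Formal_Power_Series"
begin

text \<open>
  Removing the cell with the largest entry gives a recursion for the number of standard tableaux,
  and it is also satisfied by Aitken's determinant \<open>n! det (1 / (\<alpha>\<^sub>i - \<beta>\<^sub>j)!)\<close>, where
  \<open>\<alpha>\<^sub>i = \<lambda>\<^sub>i + N - i\<close> and \<open>\<beta>\<^sub>j = \<mu>\<^sub>j + N - j\<close>. Up to row factors its entries are falling
  factorials of the \<open>\<alpha>\<^sub>i\<close>. With \<open>r = m + 1\<close>, the beta-numbers of the \<open>a + c\<close> long rows form a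
  progression \<open>x\<^sub>i\<close> of step \<open>r\<close>, and those of the other rows form the complement \<open>L\<close> of
  \<open>{0, r, \<dots>, (b + c - 1) r}\<close> in an initial segment of the naturals. Since \<open>\<mu>\<close> is a rectangle,
  the falling factorials can be replaced by Newton polynomials with nodes \<open>L\<close> followed by
  \<open>0, r, 2 r, \<dots>\<close>; the matrix becomes block triangular, and what remains is
  \<open>det (binomial (z + i) s\<^sub>j)\<close> with \<open>z = x\<^sub>0 / r\<close>, where the \<open>s\<^sub>j\<close> run through \<open>0, \<dots>, c - 1\<close> and
  \<open>b + c, \<dots>, b + c + a - 1\<close>. Row differences turn it into the Toeplitz determinant
  \<open>det (binomial z (b + j - i))\<close> of size \<open>a\<close>, so one may assume \<open>c = 0\<close>, where the entries factor.
\<close>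

section \<open>Determinants of functions\<close>

definition fdet :: "nat \<Rightarrow> (nat \<Rightarrow> nat \<Rightarrow> 'a::comm_ring_1) \<Rightarrow> 'a" where
  "fdet n f = det (mat n n (\<lambda>(i, j). f i j))"

lemma fdet_leibniz:
  "fdet n f = (\<Sum>p | p permutes {..<n}. signof p * (\<Prod>i<n. f i (p i)))"
proof -
  have "(\<Prod>i = 0..<n. mat n n (\<lambda>(i, j). f i j) $$ (i, p i)) = (\<Prod>i<n. f i (p i))"
    if "p permutes {0..<n}" for p
    using permutes_in_image[OF that] by (auto simp: atLeast0LessThan intro!: prod.cong)
  then show ?thesis
    unfolding fdet_def by (subst det_def'[of _ n]) (auto simp: atLeast0LessThan intro!: sum.cong)
qed

lemma fdet_cong:
  assumes "\<And>i j. i < n \<Longrightarrow> j < n \<Longrightarrow> f i j = g i j"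
  shows "fdet n f = fdet n g"
  unfolding fdet_def by (rule arg_cong[of _ _ det]) (auto simp: assms)

lemma fdet_transpose: "fdet n (\<lambda>i j. f j i) = fdet n f"
proof -
  have "mat n n (\<lambda>(i, j). f j i) = transpose_mat (mat n n (\<lambda>(i, j). f i j))"
    by auto
  then show ?thesis
    unfolding fdet_def by (simp add: det_transpose[of _ n])
qed

lemma fdet_scale_rows: "fdet n (\<lambda>i j. u i * f i j) = (\<Prod>i<n. u i) * fdet n f"
  unfolding fdet_leibniz by (simp add: prod.distrib sum_distrib_left ac_simps)

lemma fdet_scale_cols: "fdet n (\<lambda>i j. u j * f i j) = (\<Prod>j<n. u j) * fdet n f"
  using fdet_scale_rows[of n u "\<lambda>i j. f j i"] fdet_transpose[of n "\<lambda>i j. u j * f i j"]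
    fdet_transpose[of n f] by simp

lemma fdet_lower_triangular:
  assumes "\<And>i j. i < j \<Longrightarrow> j < n \<Longrightarrow> f i j = 0"
  shows "fdet n f = (\<Prod>i<n. f i i)"
  unfolding fdet_def using assms
  by (subst det_lower_triangular[of n])
     (auto simp: prod_list_diag_prod atLeast0LessThan intro!: prod.cong)

lemma fdet_upper_triangular:
  assumes "\<And>i j. j < i \<Longrightarrow> i < n \<Longrightarrow> f i j = 0"
  shows "fdet n f = (\<Prod>i<n. f i i)"
  using fdet_lower_triangular[of n "\<lambda>i j. f j i"] assms fdet_transpose[of n f] by simp

lemma fdet_mult: "fdet n (\<lambda>i j. \<Sum>k<n. f i k * g k j) = fdet n f * fdet n g"
proof -
  have "mat n n (\<lambda>(i, j). \<Sum>k<n. f i k * g k j)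
      = mat n n (\<lambda>(i, j). f i j) * mat n n (\<lambda>(i, j). g i j)"
    by (auto simp: scalar_prod_def atLeast0LessThan)
  then show ?thesis
    unfolding fdet_def by (simp add: det_mult[of _ n])
qed

lemma fdet_block_lower:
  fixes f :: "nat \<Rightarrow> nat \<Rightarrow> 'a::idom"
  assumes "\<And>i j. i < p \<Longrightarrow> j < q \<Longrightarrow> f i (p + j) = 0"
  shows "fdet (p + q) f = fdet p f * fdet q (\<lambda>i j. f (p + i) (p + j))"
proof -
  have "mat (p + q) (p + q) (\<lambda>(i, j). f i j) =
      four_block_mat (mat p p (\<lambda>(i, j). f i j)) (0\<^sub>m p q)
        (mat q p (\<lambda>(i, j). f (p + i) j)) (mat q q (\<lambda>(i, j). f (p + i) (p + j)))"
  proof (rule eq_matI, goal_cases)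
    case (1 i j)
    then show ?case using assms[of i "j - p"] by (auto simp: not_less)
  qed auto
  then show ?thesis
    unfolding fdet_def by (simp add: det_four_block_mat_upper_right_zero[of _ p _ q])
qed

lemma fdet_block_upper:
  fixes f :: "nat \<Rightarrow> nat \<Rightarrow> 'a::idom"
  assumes "\<And>i j. i < q \<Longrightarrow> j < p \<Longrightarrow> f (p + i) j = 0"
  shows "fdet (p + q) f = fdet p f * fdet q (\<lambda>i j. f (p + i) (p + j))"
  using fdet_block_lower[of p q "\<lambda>i j. f j i"] assms fdet_transpose[of "p + q" f]
    fdet_transpose[of p f] fdet_transpose[of q "\<lambda>i j. f (p + i) (p + j)"] by simp

lemma fdet_eq_0_if_equal_rows:
  assumes "r < n" "s < n" "r \<noteq> s" "\<And>j. j < n \<Longrightarrow> f r j = f s j"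
  shows "fdet n f = 0"
  unfolding fdet_def using assms
  by (intro det_identical_rows[of _ n r s]) auto

lemma fdet_eq_0_if_zero_corner:
  fixes f :: "nat \<Rightarrow> nat \<Rightarrow> 'a::idom"
  assumes "r < n" and zero: "\<And>i j. i \<le> r \<Longrightarrow> r \<le> j \<Longrightarrow> j < n \<Longrightarrow> f i j = 0"
  shows "fdet n f = 0"
proof -
  obtain k where n: "n = r + Suc k"
    using assms(1) less_imp_Suc_add by auto
  have "fdet n f = fdet r f * fdet (Suc k) (\<lambda>i j. f (r + i) (r + j))"
    unfolding n by (rule fdet_block_lower) (simp add: n zero)
  also have "fdet (Suc k) (\<lambda>i j. f (r + i) (r + j)) = 0"
    unfolding fdet_leibniz
  proof (intro sum.neutral ballI)
    fix p assume "p \<in> {p. p permutes {..<Suc k}}"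
    then have "p 0 < Suc k"
      using permutes_in_image[of p "{..<Suc k}" 0] by simp
    then have "f (r + 0) (r + p 0) = 0"
      by (intro zero) (simp_all add: n)
    then have "(\<Prod>i<Suc k. f (r + i) (r + p i)) = 0"
      by (intro prod_zero bexI[of _ 0]) simp_all
    then show "signof p * (\<Prod>i<Suc k. f (r + i) (r + p i)) = 0" by simp
  qed
  finally show ?thesis by simp
qed

text \<open>In Leibniz' formula the weights of a permutation \<open>p\<close> add up to \<open>\<Sum>i. x i - y (p i)\<close>, which
  does not depend on \<open>p\<close>.\<close>
lemma fdet_sum_weighted_rows:
  fixes f :: "nat \<Rightarrow> nat \<Rightarrow> 'a::comm_ring_1"
  shows "(\<Sum>r<n. fdet n (\<lambda>i j. if i = r then (x i - y j) * f i j else f i j))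
    = (\<Sum>i<n. x i - y i) * fdet n f"
proof -
  have weighted: "(\<Prod>i<n. if i = r then (x i - y (p i)) * f i (p i) else f i (p i))
      = (x r - y (p r)) * (\<Prod>i<n. f i (p i))" if "r < n" for r and p :: "nat \<Rightarrow> nat"
    using that by (subst (1 2) prod.remove[of _ r]) (auto simp: mult.assoc intro!: prod.cong)
  have sum_weights: "(\<Sum>r<n. x r - y (p r)) = (\<Sum>i<n. x i - y i)" if "p permutes {..<n}" for p
    using sum.permute[OF that, of y] by (simp add: sum_subtractf)
  have "(\<Sum>r<n. fdet n (\<lambda>i j. if i = r then (x i - y j) * f i j else f i j))
    = (\<Sum>r<n. \<Sum>p | p permutes {..<n}. signof p * ((x r - y (p r)) * (\<Prod>i<n. f i (p i))))"
    unfolding fdet_leibniz by (intro sum.cong refl) (simp add: weighted)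
  also have "\<dots> = (\<Sum>p | p permutes {..<n}.
      (\<Sum>r<n. x r - y (p r)) * (signof p * (\<Prod>i<n. f i (p i))))"
    by (subst sum.swap) (simp add: sum_distrib_right sum_distrib_left ac_simps)
  also have "\<dots> = (\<Sum>p | p permutes {..<n}.
      (\<Sum>i<n. x i - y i) * (signof p * (\<Prod>i<n. f i (p i))))"
    by (intro sum.cong refl) (simp add: sum_weights)
  finally show ?thesis by (simp add: fdet_leibniz sum_distrib_left)
qed

section \<open>Standard Young tableaux\<close>

definition syts :: "cell set \<Rightarrow> (cell \<Rightarrow> nat) set" where
  "syts S = {T \<in> extensional S. is_syt S T}"

definition maximal_cells :: "cell set \<Rightarrow> cell set" where
  "maximal_cells S =
    {(i, j) \<in> S. (\<forall>j'. (i, j') \<in> S \<longrightarrow> j' \<le> j) \<and> (\<forall>i'. (i', j) \<in> S \<longrightarrow> i' \<le> i)}"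

lemma num_syt_eq_card_syts: "num_syt S = card (syts S)"
  by (simp add: num_syt_def syts_def)

lemma num_syt_empty: "num_syt {} = 1"
  by (simp add: num_syt_def is_syt_def bij_betw_def)

lemma finite_syts: "finite S \<Longrightarrow> finite (syts S)"
  by (rule finite_subset[OF _ finite_PiE[of S "\<lambda>_. {1..card S}"]])
     (auto simp: syts_def PiE_def is_syt_def dest: bij_betwE)

lemma maximal_cells_subset: "maximal_cells S \<subseteq> S"
  by (auto simp: maximal_cells_def)

lemma maximal_cell_if_largest_entry:
  assumes "is_syt S T" "x \<in> S" "T x = card S"
  shows "x \<in> maximal_cells S"
proof -
  have "T y \<le> card S" if "y \<in> S" for y
    using assms(1) that by (auto simp: is_syt_def dest: bij_betwE)
  then show ?thesis
    using assms unfolding maximal_cells_def is_syt_def by (cases x) (simp, metis not_le)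
qed

lemma is_syt_remove_largest:
  assumes "finite S" "x \<in> S" "is_syt S T" "T x = card S"
  shows "is_syt (S - {x}) (restrict T (S - {x}))"
proof -
  have bij: "bij_betw T S {1..card S}" using assms by (simp add: is_syt_def)
  have "T ` (S - {x}) = {1..card S} - {card S}"
    using bij assms(2,4) by (auto simp: bij_betw_def inj_on_image_set_diff[of T S])
  also have "\<dots> = {1..card (S - {x})}"
    using assms(1,2) by (auto simp: card_Diff_singleton)
  finally have "bij_betw T (S - {x}) {1..card (S - {x})}"
    using bij by (auto simp: bij_betw_def intro: inj_on_subset)
  then have "bij_betw (restrict T (S - {x})) (S - {x}) {1..card (S - {x})}"
    by (subst bij_betw_cong[of _ _ T]) auto
  then show ?thesis
    using assms(3) unfolding is_syt_def by auto
qed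

lemma is_syt_insert_largest:
  assumes "finite S" "x \<in> maximal_cells S" "is_syt (S - {x}) T"
  shows "is_syt S (T(x := card S))"
proof -
  have x: "x \<in> S" using assms(2) maximal_cells_subset by blast
  then have S: "insert x (S - {x}) = S" by auto
  have card: "card S = Suc (card (S - {x}))" using x assms(1) by (metis card_Suc_Diff1)
  have bij: "bij_betw T (S - {x}) {1..card (S - {x})}" using assms(3) by (simp add: is_syt_def)
  have less: "T y < card S" if "y \<in> S" "y \<noteq> x" for y
    using bij_betwE[OF bij] that card by (simp add: less_Suc_eq_le)
  have "bij_betw (T(x := card S)) (S - {x}) {1..card (S - {x})}"
    using bij by (subst bij_betw_cong[of _ _ T]) auto
  then have "bij_betw (T(x := card S)) S (insert (card S) {1..card (S - {x})})"
    using card notIn_Un_bij_betw[of x "S - {x}" "T(x := card S)" "{1..card (S - {x})}"] S by simp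
  also have "insert (card S) {1..card (S - {x})} = {1..card S}" using card by auto
  finally have "bij_betw (T(x := card S)) S {1..card S}" .
  then show ?thesis
    using assms(2,3) less unfolding is_syt_def maximal_cells_def
    by (intro conjI) (auto simp: not_le[symmetric])
qed

lemma card_syts_largest_at:
  assumes "finite S" "x \<in> maximal_cells S"
  shows "card {T \<in> syts S. T x = card S} = num_syt (S - {x})"
proof -
  have x: "x \<in> S" using assms(2) maximal_cells_subset by blast
  have "bij_betw (\<lambda>T. restrict T (S - {x})) {T \<in> syts S. T x = card S} (syts (S - {x}))"
  proof (rule bij_betw_byWitness[where f' = "\<lambda>T. T(x := card S)"])
    show "\<forall>T\<in>{T \<in> syts S. T x = card S}. (restrict T (S - {x}))(x := card S) = T"
      using x by (auto simp: syts_def fun_eq_iff extensional_def)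
    show "\<forall>T\<in>syts (S - {x}). restrict (T(x := card S)) (S - {x}) = T"
      by (auto simp: syts_def fun_eq_iff extensional_def)
    show "(\<lambda>T. restrict T (S - {x})) ` {T \<in> syts S. T x = card S} \<subseteq> syts (S - {x})"
      using is_syt_remove_largest[OF assms(1) x] by (auto simp: syts_def)
    show "(\<lambda>T. T(x := card S)) ` syts (S - {x}) \<subseteq> {T \<in> syts S. T x = card S}"
      using is_syt_insert_largest[OF assms] x by (auto simp: syts_def extensional_def)
  qed
  then show ?thesis
    unfolding num_syt_eq_card_syts by (rule bij_betw_same_card)
qed

lemma num_syt_remove_largest:
  assumes "finite S" "S \<noteq> {}"
  shows "num_syt S = (\<Sum>x\<in>maximal_cells S. num_syt (S - {x}))"
proof -
  let ?A = "\<lambda>x. {T \<in> syts S. T x = card S}"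
  have "\<exists>x\<in>maximal_cells S. T x = card S" if "T \<in> syts S" for T
  proof -
    have T: "is_syt S T" using that by (simp add: syts_def)
    have "card S \<in> {1..card S}" using assms by (simp add: card_gt_0_iff Suc_le_eq)
    with T obtain x where "x \<in> S" "T x = card S"
      by (metis bij_betw_imp_surj_on imageE is_syt_def)
    with T show ?thesis by (blast intro: maximal_cell_if_largest_entry)
  qed
  then have "syts S = (\<Union>x\<in>maximal_cells S. ?A x)" by auto
  then have "num_syt S = card (\<Union>x\<in>maximal_cells S. ?A x)" by (simp add: num_syt_eq_card_syts)
  also have "\<dots> = (\<Sum>x\<in>maximal_cells S. card (?A x))"
  proof (rule card_UN_disjoint)
    show "finite (maximal_cells S)"
      using assms(1) maximal_cells_subset by (rule rev_finite_subset)
    show "\<forall>x\<in>maximal_cells S. finite (?A x)"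
      using finite_syts[OF assms(1)] by simp
    have "x = y" if "T \<in> ?A x" "T \<in> ?A y" "x \<in> S" "y \<in> S" for T x y
      using that by (intro inj_onD[of T S x y]) (auto simp: syts_def is_syt_def bij_betw_def)
    then show "\<forall>x\<in>maximal_cells S. \<forall>y\<in>maximal_cells S. x \<noteq> y \<longrightarrow> ?A x \<inter> ?A y = {}"
      using maximal_cells_subset by blast
  qed
  also have "\<dots> = (\<Sum>x\<in>maximal_cells S. num_syt (S - {x}))"
    by (intro sum.cong refl card_syts_largest_at assms(1))
  finally show ?thesis .
qed

section \<open>Aitken's determinant\<close>

definition inv_fact :: "int \<Rightarrow> real" where
  "inv_fact k = (if k < 0 then 0 else 1 / fact (nat k))"

lemma inv_fact_pred: "inv_fact (k - 1) = real_of_int k * inv_fact k"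
proof (cases "k \<ge> 1")
  case True
  then have "nat k = Suc (nat (k - 1))" by simp
  then have "(fact (nat k) :: real) = real_of_int k * fact (nat (k - 1))"
    using True by (simp only: fact_Suc) simp
  then show ?thesis using True by (simp add: inv_fact_def)
qed (auto simp: inv_fact_def)

definition aitken_det :: "nat \<Rightarrow> (nat \<Rightarrow> int) \<Rightarrow> (nat \<Rightarrow> int) \<Rightarrow> real" where
  "aitken_det N \<alpha> \<beta> = fdet N (\<lambda>i j. inv_fact (\<alpha> i - \<beta> j))"

lemma aitken_det_refl:
  assumes "strict_mono_on {..<N} \<beta>"
  shows "aitken_det N \<beta> \<beta> = 1"
proof -
  have "inv_fact (\<beta> i - \<beta> j) = 0" if "i < j" "j < N" for i j
    using strict_mono_onD[OF assms, of i j] that by (simp add: inv_fact_def)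
  then show ?thesis
    unfolding aitken_det_def by (subst fdet_lower_triangular) (simp_all add: inv_fact_def)
qed

lemma aitken_det_eq_0_if_less:
  assumes "mono_on {..<N} \<alpha>" "mono_on {..<N} \<beta>" "r < N" "\<alpha> r < \<beta> r"
  shows "aitken_det N \<alpha> \<beta> = 0"
  unfolding aitken_det_def
proof (rule fdet_eq_0_if_zero_corner[OF assms(3)])
  fix i j assume "i \<le> r" "r \<le> j" "j < N"
  then have "\<alpha> i \<le> \<alpha> r" "\<beta> r \<le> \<beta> j"
    using assms by (auto simp: mono_on_def)
  then show "inv_fact (\<alpha> i - \<beta> j) = 0"
    using assms(4) by (simp add: inv_fact_def)
qed

lemma aitken_det_eq_0_if_eq:
  assumes "r < N" "s < N" "r \<noteq> s" "\<alpha> r = \<alpha> s"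
  shows "aitken_det N \<alpha> \<beta> = 0"
  unfolding aitken_det_def using assms by (intro fdet_eq_0_if_equal_rows[of r _ s]) simp_all

lemma aitken_det_sum_decrement:
  "(\<Sum>r<N. aitken_det N (\<alpha>(r := \<alpha> r - 1)) \<beta>) = of_int (\<Sum>i<N. \<alpha> i - \<beta> i) * aitken_det N \<alpha> \<beta>"
proof -
  have "inv_fact ((\<alpha>(r := \<alpha> r - 1)) i - \<beta> j) =
      (if i = r then (of_int (\<alpha> i) - of_int (\<beta> j)) * inv_fact (\<alpha> i - \<beta> j)
       else inv_fact (\<alpha> i - \<beta> j))"
    for r i j
    using inv_fact_pred[of "\<alpha> i - \<beta> j"] by (auto simp: algebra_simps)
  then show ?thesis
    unfolding aitken_det_def by (simp add: fdet_sum_weighted_rows)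
qed

text \<open>Rows are counted from the bottom: \<open>lam i\<close> and \<open>mu i\<close> belong to row \<open>N - i\<close> of the diagram,
  so partitions are weakly increasing functions of \<open>i\<close>, and their beta-numbers increase strictly.\<close>
definition skew_cells :: "nat \<Rightarrow> (nat \<Rightarrow> nat) \<Rightarrow> (nat \<Rightarrow> nat) \<Rightarrow> cell set" where
  "skew_cells N lam mu = {(N - i, j) | i j. i < N \<and> mu i < j \<and> j \<le> lam i}"

definition beta_number :: "(nat \<Rightarrow> nat) \<Rightarrow> nat \<Rightarrow> int" where
  "beta_number lam i = int (lam i + i)"

definition corner_rows :: "nat \<Rightarrow> (nat \<Rightarrow> nat) \<Rightarrow> (nat \<Rightarrow> nat) \<Rightarrow> nat set" where
  "corner_rows N lam mu = {r. r < N \<and> mu r < lam r \<and> (\<forall>i<r. lam i < lam r)}"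

lemma skew_cells_iff:
  assumes "i < N"
  shows "(N - i, j) \<in> skew_cells N lam mu \<longleftrightarrow> mu i < j \<and> j \<le> lam i"
proof
  assume "(N - i, j) \<in> skew_cells N lam mu"
  then obtain i' where "N - i = N - i'" "i' < N" "mu i' < j" "j \<le> lam i'"
    by (auto simp: skew_cells_def)
  moreover from this assms have "i' = i" by linarith
  ultimately show "mu i < j \<and> j \<le> lam i" by simp
qed (use assms in \<open>auto simp: skew_cells_def\<close>)

lemma skew_cells_eq_image_Sigma:
  "skew_cells N lam mu = (\<lambda>(i, j). (N - i, j)) ` Sigma {..<N} (\<lambda>i. {mu i<..lam i})"
  by (auto simp: skew_cells_def image_iff)

lemma finite_skew_cells: "finite (skew_cells N lam mu)"
  unfolding skew_cells_eq_image_Sigma by (intro finite_imageI finite_SigmaI) auto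

lemma card_skew_cells: "card (skew_cells N lam mu) = (\<Sum>i<N. lam i - mu i)"
proof -
  have "inj_on (\<lambda>(i, j). (N - i, j)) (Sigma {..<N} (\<lambda>i. {mu i<..lam i}))"
    by (auto simp: inj_on_def)
  then show ?thesis unfolding skew_cells_eq_image_Sigma by (simp add: card_image)
qed

lemma maximal_cells_skew_cells:
  assumes "mono_on {..<N} mu"
  shows "maximal_cells (skew_cells N lam mu) = (\<lambda>r. (N - r, lam r)) ` corner_rows N lam mu"
proof (intro equalityI subsetI)
  fix x assume x: "x \<in> maximal_cells (skew_cells N lam mu)"
  then obtain r j where r: "x = (N - r, j)" "r < N" "mu r < j" "j \<le> lam r"
    by (auto simp: maximal_cells_def skew_cells_def)
  have "(N - r, lam r) \<in> skew_cells N lam mu" using r by (simp add: skew_cells_iff)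
  then have j: "j = lam r" using x r by (fastforce simp: maximal_cells_def)
  have "lam i < lam r" if "i < r" for i
  proof (rule ccontr)
    assume "\<not> lam i < lam r"
    moreover have "mu i \<le> mu r" using assms that r by (auto simp: mono_on_def)
    ultimately have "(N - i, j) \<in> skew_cells N lam mu" using r that j by (simp add: skew_cells_iff)
    then have "N - i \<le> N - r" using x r by (auto simp: maximal_cells_def)
    then show False using that r by linarith
  qed
  then show "x \<in> (\<lambda>r. (N - r, lam r)) ` corner_rows N lam mu"
    using r j by (auto simp: corner_rows_def)
next
  fix x assume "x \<in> (\<lambda>r. (N - r, lam r)) ` corner_rows N lam mu"
  then obtain r where r: "x = (N - r, lam r)" "r < N" "mu r < lam r" "\<And>i. i < r \<Longrightarrow> lam i < lam r"
    by (auto simp: corner_rows_def)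
  have "i' \<le> N - r" if "(i', lam r) \<in> skew_cells N lam mu" for i'
  proof -
    from that obtain i where i: "i' = N - i" "lam r \<le> lam i" by (auto simp: skew_cells_def)
    then have "\<not> i < r" using r(4)[of i] by auto
    then show ?thesis using i by simp
  qed
  then show "x \<in> maximal_cells (skew_cells N lam mu)"
    using r by (auto simp: maximal_cells_def skew_cells_iff)
qed

lemma skew_cells_remove_row_end:
  assumes "r < N" "mu r < lam r"
  shows "skew_cells N lam mu - {(N - r, lam r)} = skew_cells N (lam(r := lam r - 1)) mu"
proof (rule Set.set_eqI)
  fix x :: cell
  show "x \<in> skew_cells N lam mu - {(N - r, lam r)} \<longleftrightarrow>
        x \<in> skew_cells N (lam(r := lam r - 1)) mu"
  proof (cases "\<exists>i j. x = (N - i, j) \<and> i < N")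
    case True
    then obtain i j where i: "x = (N - i, j)" "i < N" by blast
    then have "x = (N - r, lam r) \<longleftrightarrow> i = r \<and> j = lam r" using assms by auto
    then show ?thesis using i assms by (auto simp: skew_cells_iff)
  next
    case False
    then show ?thesis by (auto simp: skew_cells_def)
  qed
qed

lemma num_syt_skew_cells_rec:
  assumes "mono_on {..<N} mu" "skew_cells N lam mu \<noteq> {}"
  shows "num_syt (skew_cells N lam mu) =
    (\<Sum>r\<in>corner_rows N lam mu. num_syt (skew_cells N (lam(r := lam r - 1)) mu))"
proof -
  let ?S = "skew_cells N lam mu" and ?R = "corner_rows N lam mu"
  have "num_syt ?S = (\<Sum>x\<in>maximal_cells ?S. num_syt (?S - {x}))"
    by (rule num_syt_remove_largest[OF finite_skew_cells assms(2)])
  also have "\<dots> = (\<Sum>r\<in>?R. num_syt (?S - {(N - r, lam r)}))"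
    unfolding maximal_cells_skew_cells[OF assms(1)]
    by (subst sum.reindex) (auto simp: inj_on_def corner_rows_def)
  also have "\<dots> = (\<Sum>r\<in>?R. num_syt (skew_cells N (lam(r := lam r - 1)) mu))"
    by (intro sum.cong refl) (simp add: corner_rows_def skew_cells_remove_row_end)
  finally show ?thesis .
qed

lemma strict_mono_on_beta_number:
  assumes "mono_on {..<N} lam"
  shows "strict_mono_on {..<N} (beta_number lam)"
proof (rule strict_mono_onI)
  fix i j assume "i \<in> {..<N}" "j \<in> {..<N}" "i < j"
  then show "beta_number lam i < beta_number lam j"
    using mono_onD[OF assms, of i j] by (simp add: beta_number_def)
qed

lemma aitken_det_beta_number_eq_1:
  assumes "mono_on {..<N} lam" "\<And>i. i < N \<Longrightarrow> mu i = lam i"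
  shows "aitken_det N (beta_number lam) (beta_number mu) = 1"
proof -
  have "aitken_det N (beta_number lam) (beta_number mu) =
      aitken_det N (beta_number lam) (beta_number lam)"
    unfolding aitken_det_def by (intro fdet_cong) (simp add: beta_number_def assms(2))
  also have "\<dots> = 1"
    by (rule aitken_det_refl[OF strict_mono_on_beta_number[OF assms(1)]])
  finally show ?thesis .
qed

lemma beta_number_decrement:
  assumes "lam r > 0"
  shows "beta_number (lam(r := lam r - 1)) = (beta_number lam)(r := beta_number lam r - 1)"
  using assms by (auto simp: fun_eq_iff beta_number_def)

lemma mono_on_decrement_corner_row:
  assumes "mono_on {..<N} lam" "r \<in> corner_rows N lam mu"
  shows "mono_on {..<N} (lam(r := lam r - 1))"
proof (rule mono_onI)
  fix i j assume "i \<in> {..<N}" "j \<in> {..<N}" "i \<le> j"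
  then show "(lam(r := lam r - 1)) i \<le> (lam(r := lam r - 1)) j"
    using mono_onD[OF assms(1), of i j] assms(2) by (auto simp: corner_rows_def le_less)
qed

lemma aitken_det_decrement_noncorner_row:
  assumes lam: "mono_on {..<N} lam" and mu: "mono_on {..<N} mu"
    and r: "r < N" "r \<notin> corner_rows N lam mu" "mu r \<le> lam r"
  shows "aitken_det N ((beta_number lam)(r := beta_number lam r - 1)) (beta_number mu) = 0"
    (is "aitken_det N ?\<alpha> ?\<beta> = 0")
proof (cases "mu r < lam r")
  case False
  show ?thesis
  proof (rule aitken_det_eq_0_if_less[OF _ _ r(1)])
    show "mono_on {..<N} ?\<alpha>"
    proof (rule mono_onI)
      fix i j assume "i \<in> {..<N}" "j \<in> {..<N}" "i \<le> j"
      then show "?\<alpha> i \<le> ?\<alpha> j"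
        using strict_mono_onD[OF strict_mono_on_beta_number[OF lam], of i j] by (cases "i = j") auto
    qed
    show "mono_on {..<N} ?\<beta>"
      by (rule strict_mono_on_imp_mono_on[OF strict_mono_on_beta_number[OF mu]])
    show "?\<alpha> r < ?\<beta> r" using False by (simp add: beta_number_def)
  qed
next
  case True
  then obtain i where i: "i < r" "lam r \<le> lam i" using r by (auto simp: corner_rows_def not_less)
  then have "lam i \<le> lam (r - 1)" "lam (r - 1) \<le> lam r"
    using r mono_onD[OF lam, of i "r - 1"] mono_onD[OF lam, of "r - 1" r] by simp_all
  then have "?\<alpha> r = ?\<alpha> (r - 1)" using i by (simp add: beta_number_def)
  then show ?thesis
    using i r by (intro aitken_det_eq_0_if_eq[of r _ "r - 1"]) simp_all
qed

lemma card_skew_cells_decrement: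
  assumes "r < N" "mu r < lam r"
  shows "card (skew_cells N lam mu) = Suc (card (skew_cells N (lam(r := lam r - 1)) mu))"
proof -
  have "(N - r, lam r) \<in> skew_cells N lam mu" using assms by (simp add: skew_cells_iff)
  then show ?thesis
    using card_Suc_Diff1[OF finite_skew_cells] skew_cells_remove_row_end[of r N mu lam] assms
    by fastforce
qed

lemma sum_aitken_det_corner_rows:
  assumes "mono_on {..<N} lam" "mono_on {..<N} mu" "\<And>i. i < N \<Longrightarrow> mu i \<le> lam i"
  shows "(\<Sum>r\<in>corner_rows N lam mu.
      aitken_det N (beta_number (lam(r := lam r - 1))) (beta_number mu)) =
    real (card (skew_cells N lam mu)) * aitken_det N (beta_number lam) (beta_number mu)"
proof -
  let ?\<alpha> = "beta_number lam" and ?\<beta> = "beta_number mu"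
  have "(\<Sum>i<N. ?\<alpha> i - ?\<beta> i) = (\<Sum>i<N. int (lam i - mu i))"
    using assms(3) by (intro sum.cong) (auto simp: beta_number_def)
  then have size: "(\<Sum>i<N. ?\<alpha> i - ?\<beta> i) = int (card (skew_cells N lam mu))"
    by (simp add: card_skew_cells)
  have "(\<Sum>r\<in>corner_rows N lam mu. aitken_det N (beta_number (lam(r := lam r - 1))) ?\<beta>) =
      (\<Sum>r\<in>corner_rows N lam mu. aitken_det N (?\<alpha>(r := ?\<alpha> r - 1)) ?\<beta>)"
    by (intro sum.cong refl arg_cong[of _ _ "\<lambda>\<alpha>. aitken_det N \<alpha> ?\<beta>"] beta_number_decrement)
      (auto simp: corner_rows_def)
  also have "\<dots> = (\<Sum>r<N. aitken_det N (?\<alpha>(r := ?\<alpha> r - 1)) ?\<beta>)"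
    using assms by (intro sum.mono_neutral_left)
      (auto simp: corner_rows_def intro!: aitken_det_decrement_noncorner_row)
  finally show ?thesis
    unfolding aitken_det_sum_decrement size by simp
qed

theorem num_syt_skew_cells:
  assumes "mono_on {..<N} lam" "mono_on {..<N} mu" "\<And>i. i < N \<Longrightarrow> mu i \<le> lam i"
  shows "real (num_syt (skew_cells N lam mu)) =
    fact (card (skew_cells N lam mu)) * aitken_det N (beta_number lam) (beta_number mu)"
  using assms
proof (induction "card (skew_cells N lam mu)" arbitrary: lam)
  case 0
  have "(\<Sum>i<N. lam i - mu i) = 0" using "0.hyps" by (simp add: card_skew_cells)
  then have "mu i = lam i" if "i < N" for i using "0.prems"(3)[of i] that by (simp add: le_antisym)
  then have "aitken_det N (beta_number lam) (beta_number mu) = 1"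
    by (rule aitken_det_beta_number_eq_1[OF "0.prems"(1)])
  then show ?case
    using "0.hyps" by (simp add: finite_skew_cells num_syt_empty)
next
  case (Suc n lam)
  let ?S = "skew_cells N lam mu" and ?lam = "\<lambda>r. lam(r := lam r - 1)"
  have IH: "real (num_syt (skew_cells N (?lam r) mu)) =
      fact n * aitken_det N (beta_number (?lam r)) (beta_number mu)"
    if r: "r \<in> corner_rows N lam mu" for r
  proof -
    have rN: "r < N" "mu r < lam r" using r by (auto simp: corner_rows_def)
    have "mono_on {..<N} (?lam r)"
      by (rule mono_on_decrement_corner_row[OF Suc.prems(1) r])
    moreover have "n = card (skew_cells N (?lam r) mu)"
      using Suc.hyps(2) card_skew_cells_decrement[of r N mu lam] rN by simp
    moreover have "mu i \<le> ?lam r i" if "i < N" for i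
      using Suc.prems(3)[OF that] rN by auto
    ultimately show ?thesis
      using Suc.hyps(1)[of "?lam r"] Suc.prems(2) by simp
  qed
  have nonempty: "?S \<noteq> {}" using Suc.hyps(2) by auto
  have "real (num_syt ?S) =
      (\<Sum>r\<in>corner_rows N lam mu. real (num_syt (skew_cells N (?lam r) mu)))"
    unfolding num_syt_skew_cells_rec[OF Suc.prems(2) nonempty] by (rule of_nat_sum)
  also have "\<dots> = fact n *
      (\<Sum>r\<in>corner_rows N lam mu. aitken_det N (beta_number (?lam r)) (beta_number mu))"
    unfolding sum_distrib_left by (intro sum.cong refl IH)
  also have "\<dots> = fact (card ?S) * aitken_det N (beta_number lam) (beta_number mu)"
    using sum_aitken_det_corner_rows[OF Suc.prems] Suc.hyps(2)[symmetric]
    by (simp del: One_nat_def)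
  finally show ?case .
qed

section \<open>Newton polynomials\<close>

definition newton :: "(nat \<Rightarrow> 'a::comm_ring_1) \<Rightarrow> nat \<Rightarrow> 'a \<Rightarrow> 'a" where
  "newton \<eta> s x = (\<Prod>t<s. x - \<eta> t)"

definition seq_append :: "nat \<Rightarrow> (nat \<Rightarrow> 'a) \<Rightarrow> (nat \<Rightarrow> 'a) \<Rightarrow> nat \<Rightarrow> 'a" where
  "seq_append M f g i = (if i < M then f i else g (i - M))"

definition gap :: "nat \<Rightarrow> nat \<Rightarrow> nat \<Rightarrow> nat" where
  "gap p b j = (if j < p then j else b + j)"

lemma prod_lessThan_add: "prod f {..<m + n} = prod f {..<m} * (\<Prod>i<n. f (m + i))"
  for f :: "nat \<Rightarrow> 'a::comm_monoid_mult"
  by (induction n) (simp_all add: mult.assoc)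

lemma newton_Suc: "newton \<eta> (Suc s) x = (x - \<eta> s) * newton \<eta> s x"
  by (simp add: newton_def mult.commute)

lemma newton_eq_0: "t < s \<Longrightarrow> newton \<eta> s (\<eta> t) = 0"
  unfolding newton_def by (rule prod_zero) auto

lemma newton_seq_append:
  "newton (seq_append M \<eta> \<zeta>) (M + k) x = newton \<eta> M x * newton \<zeta> k x"
  by (simp add: newton_def seq_append_def prod_lessThan_add)

lemma newton_change_basis:
  assumes "\<And>x. newton \<eta> s x = newton \<zeta> s x"
  shows "\<exists>C. C k = 1 \<and> (\<forall>x. newton \<eta> (s + k) x = (\<Sum>i\<le>k. C i * newton \<zeta> (s + i) x))"
proof (induction k)
  case 0
  then show ?case by (intro exI[of _ "\<lambda>_. 1"]) (simp add: assms)
next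
  case (Suc k)
  then obtain C where C: "C k = 1" "\<And>x. newton \<eta> (s + k) x = (\<Sum>i\<le>k. C i * newton \<zeta> (s + i) x)"
    by blast
  define raised where "raised i = (case i of 0 \<Rightarrow> 0 | Suc i' \<Rightarrow> C i')" for i
  define kept where "kept i = (if i \<le> k then C i * (\<zeta> (s + i) - \<eta> (s + k)) else 0)" for i
  have "newton \<eta> (s + Suc k) x = (\<Sum>i\<le>Suc k. (raised i + kept i) * newton \<zeta> (s + i) x)" for x
  proof -
    have "newton \<eta> (s + Suc k) x = (\<Sum>i\<le>k. C i * ((x - \<eta> (s + k)) * newton \<zeta> (s + i) x))"
      by (simp add: newton_Suc C(2) sum_distrib_left mult.left_commute)
    also have "\<dots> = (\<Sum>i\<le>k. C i * newton \<zeta> (s + Suc i) x) + (\<Sum>i\<le>k. kept i * newton \<zeta> (s + i) x)"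
      unfolding sum.distrib[symmetric]
      by (intro sum.cong) (auto simp: newton_Suc kept_def algebra_simps)
    also have "(\<Sum>i\<le>k. C i * newton \<zeta> (s + Suc i) x) = (\<Sum>i\<le>Suc k. raised i * newton \<zeta> (s + i) x)"
      by (simp only: sum.atMost_Suc_shift) (simp add: raised_def)
    also have "(\<Sum>i\<le>k. kept i * newton \<zeta> (s + i) x) = (\<Sum>i\<le>Suc k. kept i * newton \<zeta> (s + i) x)"
      by (simp add: kept_def)
    finally show ?thesis by (simp only: sum.distrib[symmetric] distrib_right)
  qed
  moreover have "raised (Suc k) + kept (Suc k) = 1" by (simp add: raised_def kept_def C(1))
  ultimately show ?case by (intro exI[of _ "\<lambda>i. raised i + kept i"]) blast
qed

lemma newton_gap_change_basis:
  assumes "\<And>x. newton \<eta> (b + p) x = newton \<zeta> (b + p) x"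
  shows "\<exists>C. C j = 1 \<and>
    (\<forall>x. newton \<eta> (gap p b j) x = (\<Sum>k\<le>j. C k * newton \<zeta> (gap p b k) x))"
proof (cases "j < p")
  case True
  have "\<exists>C. C j = 1 \<and> (\<forall>x. newton \<eta> (0 + j) x = (\<Sum>k\<le>j. C k * newton \<zeta> (0 + k) x))"
    by (rule newton_change_basis) (simp add: newton_def)
  then show ?thesis using True by (simp add: gap_def)
next
  case False
  obtain C where C: "C (j - p) = 1"
    "\<And>x. newton \<eta> (b + p + (j - p)) x = (\<Sum>k\<le>j - p. C k * newton \<zeta> (b + p + k) x)"
    using newton_change_basis[OF assms, of "j - p"] by blast
  have "(\<Sum>k\<le>j - p. C k * newton \<zeta> (b + p + k) x)
      = (\<Sum>k\<le>j. (if k < p then 0 else C (k - p)) * newton \<zeta> (gap p b k) x)" for x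
    using False
    by (intro sum.reindex_bij_witness_not_neutral[of "{}" "{..<p}" _ "\<lambda>k. k - p" "\<lambda>k. k + p"])
       (auto simp: gap_def add_ac)
  then show ?thesis using False C
    by (intro exI[of _ "\<lambda>k. if k < p then 0 else C (k - p)"]) (simp add: gap_def)
qed

text \<open>Two Newton bases that agree in degree \<open>b + p\<close> define the same flag of spans in the degrees
  \<open>0, \<dots>, p - 1, b + p, b + p + 1, \<dots>\<close>.\<close>
lemma fdet_newton_gap_change_nodes:
  assumes "\<And>x. newton \<eta> (b + p) x = newton \<zeta> (b + p) x"
  shows "fdet n (\<lambda>i j. newton \<eta> (gap p b j) (x i)) = fdet n (\<lambda>i j. newton \<zeta> (gap p b j) (x i))"
proof -
  obtain C where C: "\<And>j. C j j = 1"
    "\<And>j z. newton \<eta> (gap p b j) z = (\<Sum>k\<le>j. C j k * newton \<zeta> (gap p b k) z)"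
    using newton_gap_change_basis[OF assms] by metis
  define U where "U k j = (if k \<le> j then C j k else 0)" for k j
  have "fdet n (\<lambda>i j. newton \<eta> (gap p b j) (x i))
      = fdet n (\<lambda>i j. \<Sum>k<n. newton \<zeta> (gap p b k) (x i) * U k j)"
    by (intro fdet_cong, unfold C(2), intro sum.mono_neutral_cong_left)
       (auto simp: U_def mult.commute)
  also have "\<dots> = fdet n (\<lambda>i j. newton \<zeta> (gap p b j) (x i)) * fdet n U"
    by (rule fdet_mult)
  also have "fdet n U = 1"
    by (subst fdet_upper_triangular) (auto simp: U_def C(1))
  finally show ?thesis by simp
qed

lemma fdet_newton_seq_append:
  fixes \<eta> \<zeta> x :: "nat \<Rightarrow> 'a::idom"
  shows "fdet (M + n) (\<lambda>i j. newton (seq_append M \<eta> \<zeta>) (gap (M + c) b j) (seq_append M \<eta> x i)) =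
    (\<Prod>i<M. newton \<eta> i (\<eta> i)) *
    ((\<Prod>i<n. newton \<eta> M (x i)) * fdet n (\<lambda>i j. newton \<zeta> (gap c b j) (x i)))"
proof -
  let ?\<theta> = "seq_append M \<eta> \<zeta>" and ?x = "seq_append M \<eta> x"
  have gap_shift: "gap (M + c) b (M + j) = M + gap c b j" for j
    by (simp add: gap_def)
  have vanish: "newton ?\<theta> (gap (M + c) b j) (?x i) = 0" if "i < M" "i < j" for i j
    using newton_eq_0[of i "gap (M + c) b j" ?\<theta>] that by (simp add: seq_append_def gap_def)
  have "fdet (M + n) (\<lambda>i j. newton ?\<theta> (gap (M + c) b j) (?x i)) =
      fdet M (\<lambda>i j. newton ?\<theta> (gap (M + c) b j) (?x i)) *
      fdet n (\<lambda>i j. newton ?\<theta> (gap (M + c) b (M + j)) (?x (M + i)))"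
    by (rule fdet_block_lower) (simp add: vanish)
  also have "fdet M (\<lambda>i j. newton ?\<theta> (gap (M + c) b j) (?x i)) =
      (\<Prod>i<M. newton ?\<theta> (gap (M + c) b i) (?x i))"
    by (rule fdet_lower_triangular) (simp add: vanish)
  also have "\<dots> = (\<Prod>i<M. newton \<eta> i (\<eta> i))"
    by (intro prod.cong) (auto simp: gap_def newton_def seq_append_def)
  also have "fdet n (\<lambda>i j. newton ?\<theta> (gap (M + c) b (M + j)) (?x (M + i))) =
      fdet n (\<lambda>i j. newton \<eta> M (x i) * newton \<zeta> (gap c b j) (x i))"
    by (simp add: gap_shift newton_seq_append) (simp add: seq_append_def)
  finally show ?thesis
    by (simp add: fdet_scale_rows)
qed

section \<open>Newton polynomials with nodes in arithmetic progression\<close>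

lemma gbinomial_add_of_nat:
  fixes z :: "'a::field_char_0"
  shows "(z + of_nat i) gchoose n =
    (\<Sum>k\<le>i. of_nat (i choose k) * (if k \<le> n then z gchoose (n - k) else 0))"
proof -
  have "(z + of_nat i) gchoose n = (\<Sum>k\<in>{0..n}. of_nat (i choose k) * (z gchoose (n - k)))"
    unfolding binomial_gbinomial gbinomial_Vandermonde by (simp add: add.commute)
  also have "\<dots> =
      (\<Sum>k\<in>{0..n} \<union> {..i}. of_nat (i choose k) * (if k \<le> n then z gchoose (n - k) else 0))"
    by (intro sum.mono_neutral_cong_left) auto
  also have "\<dots> = (\<Sum>k\<le>i. of_nat (i choose k) * (if k \<le> n then z gchoose (n - k) else 0))"
    by (intro sum.mono_neutral_right) (auto simp: binomial_eq_0)
  finally show ?thesis .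
qed

lemma fdet_gbinomial_gap_eq_toeplitz:
  fixes z :: "'a::field_char_0"
  shows "fdet (c + a) (\<lambda>i j. (z + of_nat i) gchoose gap c b j) =
    fdet a (\<lambda>i j. if i \<le> b + j then z gchoose (b + j - i) else 0)"
proof -
  define H where "H k j = (if k \<le> gap c b j then z gchoose (gap c b j - k) else 0)" for k j
  have "fdet (c + a) (\<lambda>i j. (z + of_nat i) gchoose gap c b j)
      = fdet (c + a) (\<lambda>i j. \<Sum>k<c + a. of_nat (i choose k) * H k j)"
    unfolding gbinomial_add_of_nat H_def
    by (intro fdet_cong sum.mono_neutral_left) (auto simp: binomial_eq_0)
  also have "\<dots> = fdet (c + a) (\<lambda>i k. of_nat (i choose k)) * fdet (c + a) H"
    by (rule fdet_mult)
  also have "fdet (c + a) (\<lambda>i k. of_nat (i choose k) :: 'a) = 1"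
    by (subst fdet_lower_triangular) (auto simp: binomial_eq_0)
  also have "fdet (c + a) H = fdet c H * fdet a (\<lambda>i j. H (c + i) (c + j))"
    by (rule fdet_block_upper) (auto simp: H_def gap_def)
  also have "fdet c H = 1"
    by (subst fdet_upper_triangular) (auto simp: H_def gap_def)
  also have "fdet a (\<lambda>i j. H (c + i) (c + j))
      = fdet a (\<lambda>i j. if i \<le> b + j then z gchoose (b + j - i) else 0)"
    by (intro fdet_cong) (auto simp: H_def gap_def intro!: arg_cong[of _ _ "\<lambda>k. z gchoose k"])
  finally show ?thesis by simp
qed

lemma fdet_gbinomial_consecutive:
  fixes z :: "'a::field_char_0"
  shows "fdet n (\<lambda>i j. (z + of_nat i) gchoose j) = 1"
proof -
  have "fdet n (\<lambda>i j. (z + of_nat i) gchoose j) =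
      fdet (n + 0) (\<lambda>i j. (z + of_nat i) gchoose gap n 0 j)"
    unfolding add_0_right by (rule fdet_cong) (simp add: gap_def)
  then show ?thesis
    by (simp only: fdet_gbinomial_gap_eq_toeplitz) (simp add: fdet_leibniz)
qed

text \<open>The Toeplitz determinant does not depend on \<open>c\<close>, and for \<open>c = 0\<close> trinomial revision factors
  the entries of the original matrix.\<close>
lemma fdet_gbinomial_gap:
  fixes z :: "'a::field_char_0"
  shows "fdet (c + a) (\<lambda>i j. (z + of_nat i) gchoose gap c b j) =
    (\<Prod>j<a. ((z + of_nat j) gchoose b) / of_nat ((b + j) choose b))"
proof -
  have "fdet (c + a) (\<lambda>i j. (z + of_nat i) gchoose gap c b j) =
      fdet (0 + a) (\<lambda>i j. (z + of_nat i) gchoose gap 0 b j)"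
    by (simp only: fdet_gbinomial_gap_eq_toeplitz)
  also have "\<dots> = fdet a (\<lambda>i j. ((z + of_nat i) gchoose b) *
      (1 / of_nat ((b + j) choose b) * ((z - of_nat b + of_nat i) gchoose j)))"
    unfolding add_0
  proof (rule fdet_cong)
    fix i j
    have "((z + of_nat i) gchoose (b + j)) * of_nat ((b + j) choose b) =
        ((z + of_nat i) gchoose b) * ((z - of_nat b + of_nat i) gchoose j)"
      using gbinomial_trinomial_revision[of b "b + j" "z + of_nat i"]
      by (simp add: binomial_gbinomial diff_add_eq)
    moreover have "of_nat ((b + j) choose b) \<noteq> (0 :: 'a)"
      by simp
    ultimately show "((z + of_nat i) gchoose gap 0 b j) = ((z + of_nat i) gchoose b) *
        (1 / of_nat ((b + j) choose b) * ((z - of_nat b + of_nat i) gchoose j))"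
      by (simp add: gap_def eq_divide_eq)
  qed
  also have "\<dots> = (\<Prod>j<a. (z + of_nat j) gchoose b) * (\<Prod>j<a. 1 / of_nat ((b + j) choose b))"
    by (simp only: fdet_scale_rows fdet_scale_cols fdet_gbinomial_consecutive mult_1_right)
  finally show ?thesis by (simp flip: prod.distrib)
qed

lemma newton_progression:
  fixes r :: "'a::field_char_0"
  shows "newton (\<lambda>t. r * of_nat t) s (r * z) = r ^ s * fact s * (z gchoose s)"
proof -
  have "newton (\<lambda>t. r * of_nat t) s (r * z) = r ^ s * (\<Prod>t<s. z - of_nat t)"
    by (simp add: newton_def prod.distrib flip: right_diff_distrib)
  then show ?thesis by (simp add: mult.assoc gbinomial_mult_fact atLeast0LessThan)
qed

lemma fdet_newton_progression:
  fixes r \<xi> :: "'a::field_char_0"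
  assumes "r \<noteq> 0"
  shows "fdet (c + a) (\<lambda>i j. newton (\<lambda>t. r * of_nat t) (gap c b j) (\<xi> + r * of_nat i)) =
    (\<Prod>j<c + a. r ^ j) * (\<Prod>j<c. fact j) *
    (\<Prod>j<a. newton (\<lambda>t. r * of_nat t) b (\<xi> + r * of_nat j) *
      fact (b + c + j) * fact j / fact (b + j))"
proof -
  define z where "z = \<xi> / r"
  let ?newton = "newton (\<lambda>t. r * of_nat t)"
  have \<xi>: "\<xi> + r * of_nat i = r * (z + of_nat i)" for i
    using assms by (simp add: z_def distrib_left)
  have "fdet (c + a) (\<lambda>i j. ?newton (gap c b j) (\<xi> + r * of_nat i)) =
      (\<Prod>j<c + a. r ^ gap c b j * fact (gap c b j)) *
      (\<Prod>j<a. ((z + of_nat j) gchoose b) / of_nat ((b + j) choose b))"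
    by (simp only: \<xi> newton_progression fdet_scale_cols fdet_gbinomial_gap)
  also have "(\<Prod>j<c + a. r ^ gap c b j * fact (gap c b j)) =
      (\<Prod>j<c + a. r ^ j) * (\<Prod>j<c. fact j) * (\<Prod>j<a. r ^ b * fact (b + c + j))"
    unfolding prod_lessThan_add by (simp add: gap_def prod.distrib power_add ac_simps)
  also have "\<dots> * (\<Prod>j<a. ((z + of_nat j) gchoose b) / of_nat ((b + j) choose b)) =
      (\<Prod>j<c + a. r ^ j) * (\<Prod>j<c. fact j) *
      (\<Prod>j<a. r ^ b * fact (b + c + j) * (((z + of_nat j) gchoose b) / of_nat ((b + j) choose b)))"
    by (simp only: prod.distrib mult.assoc)
  also have
    "(\<Prod>j<a. r ^ b * fact (b + c + j) * (((z + of_nat j) gchoose b) / of_nat ((b + j) choose b))) =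
      (\<Prod>j<a. ?newton b (\<xi> + r * of_nat j) * fact (b + c + j) * fact j / fact (b + j))"
    unfolding \<xi> newton_progression by (simp add: binomial_fact field_simps)
  finally show ?thesis .
qed

section \<open>Complementary sets of beta-numbers\<close>

definition vandermonde :: "nat set \<Rightarrow> real" where
  "vandermonde A = (\<Prod>y\<in>A. \<Prod>x\<in>{x \<in> A. x < y}. real y - real x)"

lemma vandermonde_insert:
  assumes "finite A" "y \<notin> A"
  shows "vandermonde (insert y A) = vandermonde A * (\<Prod>x\<in>A. \<bar>real x - real y\<bar>)"
proof -
  let ?w = "\<lambda>y x. if x < y then real y - real x else 1"
  have vandermonde: "vandermonde B = (\<Prod>y\<in>B. \<Prod>x\<in>B. ?w y x)" if "finite B" for B
    unfolding vandermonde_def using that by (simp add: prod.inter_filter)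
  have "vandermonde (insert y A) = vandermonde A * ((\<Prod>x\<in>A. ?w x y) * (\<Prod>x\<in>A. ?w y x))"
    using assms by (simp add: vandermonde prod.distrib algebra_simps)
  also have "(\<Prod>x\<in>A. ?w x y) * (\<Prod>x\<in>A. ?w y x) = (\<Prod>x\<in>A. \<bar>real x - real y\<bar>)"
    unfolding prod.distrib[symmetric] using assms by (intro prod.cong) auto
  finally show ?thesis .
qed

lemma vandermonde_strict_mono_image:
  assumes "strict_mono_on {..<n} f"
  shows "vandermonde (f ` {..<n}) = (\<Prod>i<n. newton (\<lambda>t. real (f t)) i (real (f i)))"
  using assms
proof (induction n)
  case 0
  show ?case by (simp add: vandermonde_def)
next
  case (Suc n)
  have less: "f i < f n" if "i < n" for i
    using strict_mono_onD[OF Suc.prems, of i n] that by simp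
  have inj: "inj_on f {..<n}"
    using strict_mono_on_imp_inj_on[OF Suc.prems] by (rule inj_on_subset) auto
  have "(\<Prod>x\<in>f ` {..<n}. \<bar>real x - real (f n)\<bar>) = newton (\<lambda>t. real (f t)) n (real (f n))"
    unfolding newton_def by (subst prod.reindex[OF inj]) (auto dest!: less intro!: prod.cong)
  moreover have "f n \<notin> f ` {..<n}"
    using less by force
  moreover have "vandermonde (f ` {..<n}) = (\<Prod>i<n. newton (\<lambda>t. real (f t)) i (real (f i)))"
    using Suc.prems by (intro Suc.IH) (auto simp: strict_mono_on_def)
  ultimately show ?case
    by (simp add: lessThan_Suc vandermonde_insert mult.commute)
qed

lemma vandermonde_progression:
  assumes "r > 0"
  shows "vandermonde ((\<lambda>t. r * t) ` {..<n}) = (\<Prod>j<n. real r ^ j) * (\<Prod>j<n. fact j)"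
proof -
  have "strict_mono_on {..<n} (\<lambda>t. r * t)" using assms by (auto simp: strict_mono_on_def)
  then have "vandermonde ((\<lambda>t. r * t) ` {..<n})
      = (\<Prod>j<n. newton (\<lambda>t. real r * real t) j (real r * real j))"
    by (simp add: vandermonde_strict_mono_image)
  then show ?thesis
    by (simp add: newton_progression prod.distrib flip: binomial_gbinomial)
qed

lemma newton_of_nat_eq_fact_div_fact:
  assumes "m \<le> n"
  shows "newton real m (real n) = fact n / fact (n - m)"
proof -
  have "newton real m (real n) = fact m * real (n choose m)"
    unfolding binomial_gbinomial gbinomial_mult_fact by (simp add: newton_def atLeast0LessThan)
  then show ?thesis using assms by (simp add: binomial_fact)
qed

lemma vandermonde_lessThan: "vandermonde {..<n} = (\<Prod>k<n. fact k)"
  using vandermonde_progression[of 1 n] by simp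

lemma prod_abs_diff_lessThan:
  assumes "y < K"
  shows "(\<Prod>u\<in>{..<K} - {y}. \<bar>real u - real y\<bar>) = fact y * fact (K - 1 - y)"
proof -
  have split: "{..<K} - {y} = {..<y} \<union> {y<..<K}" using assms by auto
  have "(\<Prod>u\<in>{..<K} - {y}. \<bar>real u - real y\<bar>)
      = (\<Prod>u<y. \<bar>real u - real y\<bar>) * (\<Prod>u\<in>{y<..<K}. \<bar>real u - real y\<bar>)"
    unfolding split by (rule prod.union_disjoint) auto
  also have "(\<Prod>u<y. \<bar>real u - real y\<bar>) = newton real y (real y)"
    unfolding newton_def by (intro prod.cong) auto
  also have "(\<Prod>u\<in>{y<..<K}. \<bar>real u - real y\<bar>) = (\<Prod>t<K - 1 - y. real (Suc t))"
    by (rule prod.reindex_bij_witness[of _ "\<lambda>t. Suc (y + t)" "\<lambda>u. u - y - 1"])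
       (use assms in auto)
  finally show ?thesis
    by (simp add: newton_of_nat_eq_fact_div_fact fact_prod_Suc atLeast0LessThan)
qed

text \<open>Complementary sets of beta-numbers belong to conjugate partitions, and for either of them the
  Vandermonde product divided by the product of factorials is the reciprocal of the hook product.\<close>
lemma vandermonde_complement:
  assumes "finite Y" "Y \<subseteq> {..<K}"
  shows "vandermonde ({..<K} - Y) * (\<Prod>y\<in>Y. fact (K - 1 - y)) =
    vandermonde Y * (\<Prod>l\<in>{..<K} - Y. fact l)"
  using assms
proof (induction Y rule: finite_induct)
  case empty
  then show ?case using vandermonde_lessThan[of K] by (simp add: vandermonde_def)
next
  case (insert y Y)
  let ?L = "{..<K} - insert y Y"
  let ?pL = "\<Prod>x\<in>?L. \<bar>real x - real y\<bar>" and ?pY = "\<Prod>x\<in>Y. \<bar>real x - real y\<bar>"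
  have y: "y < K" "{..<K} - Y = insert y ?L" using insert by auto
  have "{..<K} - {y} = ?L \<union> Y" using insert by auto
  then have "(\<Prod>u\<in>{..<K} - {y}. \<bar>real u - real y\<bar>) = ?pL * ?pY"
    using insert by (simp only:) (intro prod.union_disjoint; auto)
  then have distances: "?pL * ?pY = fact y * fact (K - 1 - y)"
    using prod_abs_diff_lessThan[OF y(1)] by simp
  have "vandermonde ({..<K} - Y) * (\<Prod>y\<in>Y. fact (K - 1 - y)) =
      vandermonde Y * (\<Prod>l\<in>{..<K} - Y. fact l)"
    using insert by blast
  then have "vandermonde ?L * ?pL * (\<Prod>y\<in>Y. fact (K - 1 - y)) =
      vandermonde Y * (fact y * (\<Prod>l\<in>?L. fact l))"
    unfolding y(2) by (subst (asm) vandermonde_insert) auto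
  then have "vandermonde ?L * (?pL * ?pY) * (\<Prod>y\<in>Y. fact (K - 1 - y)) =
      fact y * (vandermonde Y * ?pY * (\<Prod>l\<in>?L. fact l))"
    by (simp add: ac_simps)
  then have "vandermonde ?L * (fact (K - 1 - y) * (\<Prod>y\<in>Y. fact (K - 1 - y))) =
      vandermonde Y * ?pY * (\<Prod>l\<in>?L. fact l)"
    unfolding distances by simp
  then show ?case using insert by (simp add: vandermonde_insert)
qed

lemma inv_fact_diff_eq_newton: "inv_fact (int l - int m) = 1 / fact l * newton real m (real l)"
proof (cases "m \<le> l")
  case True
  then have "nat (int l - int m) = l - m" by simp
  then show ?thesis using True by (simp add: inv_fact_def newton_of_nat_eq_fact_div_fact)
next
  case False
  then show ?thesis using newton_eq_0[of l m real] by (simp add: inv_fact_def)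
qed

lemma aitken_det_eq_fdet_newton:
  "aitken_det N (\<lambda>i. int (l i)) (\<lambda>j. int (k j)) =
    (\<Prod>i<N. 1 / fact (l i)) * fdet N (\<lambda>i j. newton real (k j) (real (l i)))"
  by (simp only: aitken_det_def inv_fact_diff_eq_newton fdet_scale_rows)

locale complementary_beta_numbers =
  fixes M q :: nat and l y :: "nat \<Rightarrow> nat"
  assumes strict_mono_l: "strict_mono_on {..<M} l"
    and inj_y: "inj_on y {..<q}"
    and range_y: "y ` {..<q} \<subseteq> {..<M + q}"
    and range_l: "l ` {..<M} = {..<M + q} - y ` {..<q}"
begin

lemma newton_eq_newton_mult_newton:
  "newton real (M + q) z = newton (\<lambda>t. real (l t)) M z * newton (\<lambda>t. real (y t)) q z"
proof -
  have "newton real (M + q) z =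
      (\<Prod>u\<in>{..<M + q} - y ` {..<q}. z - real u) * (\<Prod>u\<in>y ` {..<q}. z - real u)"
    unfolding newton_def by (rule prod.subset_diff[OF range_y]) simp
  then show ?thesis
    unfolding range_l[symmetric] newton_def
    by (simp add: prod.reindex inj_y strict_mono_on_imp_inj_on[OF strict_mono_l])
qed

lemma newton_l_div_fact:
  assumes "M + q \<le> x"
  shows "newton (\<lambda>t. real (l t)) M (real x) / fact x =
    1 / (fact (x - (M + q)) * newton (\<lambda>t. real (y t)) q (real x))"
proof -
  have "y t < x" if "t < q" for t
    using range_y assms that by (meson image_subset_iff lessThan_iff less_le_trans)
  then have "newton (\<lambda>t. real (y t)) q (real x) > 0"
    unfolding newton_def by (intro prod_pos) auto
  moreover have "newton (\<lambda>t. real (l t)) M (real x) * newton (\<lambda>t. real (y t)) q (real x) =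
      fact x / fact (x - (M + q))"
    using assms by (simp add: newton_of_nat_eq_fact_div_fact flip: newton_eq_newton_mult_newton)
  ultimately show ?thesis by (simp add: field_simps)
qed

lemma prod_newton_l_div_fact:
  "(\<Prod>i<M. newton (\<lambda>t. real (l t)) i (real (l i)) / fact (l i)) =
    vandermonde (y ` {..<q}) / (\<Prod>t<q. fact (M + q - 1 - y t))"
proof -
  have "vandermonde (l ` {..<M}) * (\<Prod>u\<in>y ` {..<q}. fact (M + q - 1 - u)) =
      vandermonde (y ` {..<q}) * (\<Prod>u\<in>l ` {..<M}. fact u)"
    unfolding range_l by (rule vandermonde_complement[OF _ range_y]) simp
  then have "(\<Prod>i<M. newton (\<lambda>t. real (l t)) i (real (l i))) * (\<Prod>t<q. fact (M + q - 1 - y t)) =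
      vandermonde (y ` {..<q}) * (\<Prod>i<M. fact (l i))"
    by (simp add: prod.reindex inj_y strict_mono_on_imp_inj_on strict_mono_l
        vandermonde_strict_mono_image)
  then show ?thesis by (simp add: prod_dividef frac_eq_eq)
qed

lemma aitken_det_gap:
  assumes q: "q = b + c" and x: "\<And>i. i < n \<Longrightarrow> M + q \<le> x i"
  shows "aitken_det (M + n) (\<lambda>i. int (seq_append M l x i)) (\<lambda>j. int (gap (M + c) b j)) =
    vandermonde (y ` {..<q}) / (\<Prod>t<q. fact (M + q - 1 - y t)) *
    (\<Prod>i<n. 1 / (fact (x i - (M + q)) * newton (\<lambda>t. real (y t)) q (real (x i)))) *
    fdet n (\<lambda>i j. newton (\<lambda>t. real (y t)) (gap c b j) (real (x i)))"
proof -
  let ?l = "\<lambda>t. real (l t)" and ?x = "\<lambda>i. real (x i)" and ?y = "\<lambda>t. real (y t)"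
  have real_seq_append: "real (seq_append M l x i) = seq_append M ?l ?x i" for i
    by (simp add: seq_append_def)
  have "newton real (b + (M + c)) z = newton (seq_append M ?l ?y) (b + (M + c)) z" for z
    using newton_eq_newton_mult_newton[of z] newton_seq_append[of M ?l ?y q z]
    by (simp add: q add_ac)
  then have "fdet (M + n) (\<lambda>i j. newton real (gap (M + c) b j) (real (seq_append M l x i))) =
      fdet (M + n) (\<lambda>i j. newton (seq_append M ?l ?y) (gap (M + c) b j) (seq_append M ?l ?x i))"
    unfolding real_seq_append by (rule fdet_newton_gap_change_nodes)
  then have "aitken_det (M + n) (\<lambda>i. int (seq_append M l x i)) (\<lambda>j. int (gap (M + c) b j)) =
      (\<Prod>i<M + n. 1 / fact (seq_append M l x i)) *
      ((\<Prod>i<M. newton ?l i (?l i)) *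
      ((\<Prod>i<n. newton ?l M (?x i)) * fdet n (\<lambda>i j. newton ?y (gap c b j) (?x i))))"
    by (simp only: aitken_det_eq_fdet_newton fdet_newton_seq_append)
  also have "(\<Prod>i<M + n. 1 / fact (seq_append M l x i)) =
      (\<Prod>i<M. 1 / fact (l i)) * (\<Prod>i<n. 1 / fact (x i) :: real)"
    by (simp add: prod_lessThan_add seq_append_def)
  also have "\<dots> * ((\<Prod>i<M. newton ?l i (?l i)) *
      ((\<Prod>i<n. newton ?l M (?x i)) * fdet n (\<lambda>i j. newton ?y (gap c b j) (?x i)))) =
      (\<Prod>i<M. newton ?l i (?l i) / fact (l i)) * (\<Prod>i<n. newton ?l M (?x i) / fact (x i)) *
      fdet n (\<lambda>i j. newton ?y (gap c b j) (?x i))"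
    by (simp add: prod_dividef)
  finally show ?thesis
    by (simp add: prod_newton_l_div_fact newton_l_div_fact x)
qed

end

section \<open>Conjugate partitions\<close>

text \<open>Row \<open>i\<close> of a diagram whose column \<open>t < q\<close> reaches down to row \<open>h t\<close>; rows are again counted
  from the bottom.\<close>
definition conj_row :: "nat \<Rightarrow> (nat \<Rightarrow> nat) \<Rightarrow> nat \<Rightarrow> nat" where
  "conj_row q h i = card {t. t < q \<and> h t \<le> i}"

lemma conj_row_le: "conj_row q h i \<le> q"
  unfolding conj_row_def using card_mono[of "{..<q}" "{t. t < q \<and> h t \<le> i}"] by auto

lemma conj_row_mono: "i \<le> i' \<Longrightarrow> conj_row q h i \<le> conj_row q h i'"
  unfolding conj_row_def by (intro card_mono) auto

lemma less_conj_row_iff: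
  assumes "mono_on {..<q} h"
  shows "k < conj_row q h i \<longleftrightarrow> k < q \<and> h k \<le> i"
proof -
  define n where "n = (LEAST t. \<not> (t < q \<and> h t \<le> i))"
  have "\<not> (n < q \<and> h n \<le> i)"
    unfolding n_def by (rule LeastI[of _ q]) simp
  then have "t < n" if "t < q" "h t \<le> i" for t
    using that mono_onD[OF assms, of n t] by (fastforce simp: not_less[symmetric])
  moreover have "t < q \<and> h t \<le> i" if "t < n" for t
    using not_less_Least[OF that[unfolded n_def]] by blast
  ultimately have "{t. t < q \<and> h t \<le> i} = {..<n}" by auto
  then show ?thesis by (simp add: conj_row_def set_eq_iff)
qed

lemma complementary_beta_numbers_conj_row:
  assumes h: "mono_on {..<q} h" and h_le: "\<And>t. t < q \<Longrightarrow> h t \<le> M"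
  shows "complementary_beta_numbers M q (\<lambda>i. conj_row q h i + i) (\<lambda>t. h t + t)"
proof
  let ?L = "(\<lambda>i. conj_row q h i + i) ` {..<M}" and ?Y = "(\<lambda>t. h t + t) ` {..<q}"
  show mono_l: "strict_mono_on {..<M} (\<lambda>i. conj_row q h i + i)"
    using conj_row_mono by (intro strict_mono_onI) (simp add: add_le_less_mono)
  have "strict_mono_on {..<q} (\<lambda>t. h t + t)"
    using mono_onD[OF h] by (intro strict_mono_onI) (simp add: add_le_less_mono)
  then show inj_y: "inj_on (\<lambda>t. h t + t) {..<q}"
    by (rule strict_mono_on_imp_inj_on)
  show range_y: "?Y \<subseteq> {..<M + q}"
    using h_le by (auto intro: add_le_less_mono)
  have "conj_row q h i + i \<noteq> h t + t" if "t < q" for i t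
    using less_conj_row_iff[OF h, of t i] that by (cases "h t \<le> i") auto
  then have "?L \<inter> ?Y = {}" by auto
  moreover have "?L \<subseteq> {..<M + q}"
    using conj_row_le by (auto simp: add.commute[of M] intro!: add_le_less_mono)
  ultimately have "?L \<subseteq> {..<M + q} - ?Y" by blast
  moreover have "card ?L = card ({..<M + q} - ?Y)"
    using range_y
    by (simp add: card_Diff_subset card_image inj_y strict_mono_on_imp_inj_on[OF mono_l])
  ultimately show "?L = {..<M + q} - ?Y"
    by (intro card_subset_eq) auto
qed

section \<open>Superfactorials\<close>

lemma superfact_eq: "superfact n = (\<Prod>k<n. fact k)"
  unfolding superfact_def by (rule prod.mono_neutral_left) (auto simp: not_less_eq_eq)

lemma superfact_nonzero: "superfact n \<noteq> 0"
  by (simp add: superfact_eq)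

lemma superfact_add: "superfact (k + n) = superfact k * (\<Prod>j<n. fact (k + j))"
  by (simp add: superfact_eq prod_lessThan_add)

lemma prod_fact_eq_superfact_quotient:
  "(\<Prod>j<c. fact j) * (\<Prod>j<a. fact (b + c + j) * fact j / fact (b + j)) =
    real (superfact (a + b + c) * superfact a * superfact b * superfact c) /
    real (superfact (a + b) * superfact (b + c))"
proof -
  have "real (superfact (a + b + c)) = superfact (b + c) * (\<Prod>j<a. fact (b + c + j))"
    "real (superfact (a + b)) = superfact b * (\<Prod>j<a. fact (b + j))"
    using superfact_add[of "b + c" a] superfact_add[of b a] by (simp_all add: add_ac)
  then show ?thesis
    by (simp add: superfact_nonzero prod_dividef prod.distrib superfact_eq)
qed

lemma falling_fact_mult_fact: "falling_fact (k + m) m * fact k = fact (k + m)"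
proof (induction m)
  case (Suc m)
  have "falling_fact (k + Suc m) (Suc m) = Suc (k + m) * falling_fact (k + m) m"
    unfolding falling_fact_def prod.lessThan_Suc_shift by simp
  then have "falling_fact (k + Suc m) (Suc m) * fact k =
      Suc (k + m) * (falling_fact (k + m) m * fact k)"
    by (simp only: mult.assoc)
  then show ?case unfolding Suc by simp
qed (simp add: falling_fact_def)

lemma fact_multiple_Suc:
  "fact (Suc j * (m + 1)) =
    fact (j * (m + 1)) * (Suc j * (m + 1)) * falling_fact (Suc j * m + Suc j - 1) m"
proof -
  have "Suc j * (m + 1) = Suc (j * (m + 1) + m)" "Suc j * m + Suc j - 1 = j * (m + 1) + m"
    by simp_all
  then show ?thesis
    by (simp only: fact_Suc of_nat_id flip: falling_fact_mult_fact[of "j * (m + 1)" m])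
      (simp only: mult_ac)
qed

lemma fact_multiple_eq_prod_falling_fact:
  "fact (i * (m + 1)) = (m + 1) ^ i * fact i * (\<Prod>j\<in>{1..i}. falling_fact (j * m + j - 1) m)"
proof (induction i)
  case (Suc i)
  have "(\<Prod>j\<in>{1..Suc i}. falling_fact (j * m + j - 1) m)
    = (\<Prod>j\<in>{1..i}. falling_fact (j * m + j - 1) m) * falling_fact (Suc i * m + Suc i - 1) m"
    by simp
  then show ?case
    unfolding fact_multiple_Suc Suc by (simp only: power_Suc fact_Suc of_nat_id mult_ac)
qed simp

lemma prod_fact_multiples:
  "(\<Prod>i<n. fact (i * (m + 1))) =
    (\<Prod>i<n. real (m + 1) ^ i) * real (superfact n) * real (Psi m n)"
proof -
  have "Psi m n = (\<Prod>i<n. \<Prod>j\<in>{1..i}. falling_fact (j * m + j - 1) m)"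
    unfolding Psi_def by (rule prod.mono_neutral_left) (auto simp: not_less_eq_eq)
  then have "(\<Prod>i<n. fact (i * (m + 1))) = (\<Prod>i<n. (m + 1) ^ i) * superfact n * Psi m n"
    by (simp only: fact_multiple_eq_prod_falling_fact superfact_eq prod.distrib)
  from arg_cong[OF this, of real] show ?thesis
    by (simp only: of_nat_mult of_nat_prod of_nat_fact of_nat_power)
qed

lemma Psi_nonzero: "Psi m n \<noteq> 0"
proof
  assume "Psi m n = 0"
  then have "(\<Prod>i<n. fact (i * (m + 1)) :: real) = 0"
    unfolding prod_fact_multiples by simp
  then show False by simp
qed

section \<open>The shapes \<open>\<Lambda>(a, b, c, d, e, m)\<close>\<close>

lemma eq_skew_cellsI:
  assumes "\<And>i j. (i, j) \<in> S \<Longrightarrow> 1 \<le> i \<and> i \<le> N"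
    and "\<And>i j. i < N \<Longrightarrow> (N - i, j) \<in> S \<longleftrightarrow> mu i < j \<and> j \<le> lam i"
  shows "S = skew_cells N lam mu"
proof -
  have "(i, j) \<in> S \<longleftrightarrow> (i, j) \<in> skew_cells N lam mu" for i j
  proof (cases "1 \<le> i \<and> i \<le> N")
    case True
    then have "N - (N - i) = i" "N - i < N" by auto
    then show ?thesis
      using assms(2)[of "N - i" j] skew_cells_iff[of "N - i" N j lam mu] by simp
  next
    case False
    then show ?thesis using assms(1)[of i j] by (auto simp: skew_cells_def)
  qed
  then show ?thesis by auto
qed

locale Lambda_parameters =
  fixes a b c d e m :: nat
begin

text \<open>The number of rows below the \<open>(a + c) \<times> (b + c)\<close> rectangle; for \<open>b + c = 0\<close> these rows are
  empty.\<close>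
definition depth :: nat where
  "depth = e + (b + c - 1) * m"

definition outer_row :: "nat \<Rightarrow> nat" where
  "outer_row = seq_append depth (conj_row (b + c) (\<lambda>t. t * m)) (\<lambda>i. b + c + d + i * m)"

definition inner_row :: "nat \<Rightarrow> nat" where
  "inner_row = seq_append (depth + c) (\<lambda>_. 0) (\<lambda>_. b)"

definition lower_beta :: "nat \<Rightarrow> nat" where
  "lower_beta i = conj_row (b + c) (\<lambda>t. t * m) i + i"

definition upper_beta :: "nat \<Rightarrow> nat" where
  "upper_beta i = depth + (b + c) + d + i * (m + 1)"

lemma mono_on_mult_m: "mono_on {..<b + c} (\<lambda>t. t * m)"
  by (simp add: mono_onI)

lemma mult_m_le_depth: "t < b + c \<Longrightarrow> t * m \<le> depth"
  unfolding depth_def by (intro trans_le_add2 mult_le_mono1) simp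

lemma Lambda_shape_row_le:
  assumes "(i, j) \<in> Lambda_shape a b c d e m"
  shows "i \<le> depth + (c + a)"
proof -
  have "1 \<le> j" "i \<le> a + c \<or> j \<le> b + c \<and> i \<le> a + c + theta b c e m j"
    using assms by (auto simp: Lambda_shape_def outer_shape_def)
  moreover have "theta b c e m j \<le> depth" if "1 \<le> j"
    unfolding theta_def depth_def using that by (intro add_left_mono mult_le_mono1) auto
  ultimately show ?thesis by linarith
qed

lemma Lambda_shape_lower_row:
  assumes "i < depth"
  shows "(depth + (c + a) - i, j) \<in> Lambda_shape a b c d e m \<longleftrightarrow>
    0 < j \<and> j \<le> conj_row (b + c) (\<lambda>t. t * m) i"
proof (cases j)
  case (Suc k)
  have "(b + c - 1) * m = (b + c - j) * m + k * m" if "k < b + c"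
    using that unfolding Suc by (simp flip: add_mult_distrib)
  then have "depth + (c + a) - i \<le> a + c + theta b c e m j \<longleftrightarrow> k * m \<le> i" if "k < b + c"
    using assms that by (simp add: theta_def depth_def, linarith)
  then show ?thesis
    using assms less_conj_row_iff[OF mono_on_mult_m, of k i]
    by (auto simp: Lambda_shape_def outer_shape_def rect_shape_def Suc Suc_le_eq)
qed (simp add: Lambda_shape_def outer_shape_def)

lemma Lambda_shape_upper_row:
  assumes "i < c + a"
  shows "(c + a - i, j) \<in> Lambda_shape a b c d e m \<longleftrightarrow>
    (if i < c then 0 else b) < j \<and> j \<le> b + c + d + i * m"
proof -
  have "nu a c d m (c + a - i) = d + i * m" using assms by (simp add: nu_def)
  then show ?thesis
    using assms by (auto simp: Lambda_shape_def outer_shape_def rect_shape_def)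
qed

lemma Lambda_shape_eq_skew_cells:
  "Lambda_shape a b c d e m = skew_cells (depth + (c + a)) outer_row inner_row"
proof (rule eq_skew_cellsI)
  fix i j assume "(i, j) \<in> Lambda_shape a b c d e m"
  then show "1 \<le> i \<and> i \<le> depth + (c + a)"
    using Lambda_shape_row_le by (auto simp: Lambda_shape_def outer_shape_def)
next
  fix i j assume i: "i < depth + (c + a)"
  show "(depth + (c + a) - i, j) \<in> Lambda_shape a b c d e m \<longleftrightarrow>
    inner_row i < j \<and> j \<le> outer_row i"
  proof (cases "i < depth")
    case True
    then show ?thesis
      by (simp add: Lambda_shape_lower_row outer_row_def inner_row_def seq_append_def)
  next
    case False
    then obtain k where "i = depth + k" by (auto simp: not_less le_iff_add)
    then show ?thesis
      using i Lambda_shape_upper_row[of k j]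
      by (simp add: outer_row_def inner_row_def seq_append_def)
  qed
qed

lemma mono_on_outer_row: "mono_on {..<N} outer_row"
proof (rule mono_onI)
  fix i j :: nat assume "i \<le> j"
  moreover have "conj_row (b + c) (\<lambda>t. t * m) i \<le> b + c + (d + (j - depth) * m)"
    using conj_row_le[of "b + c" "\<lambda>t. t * m" i] by linarith
  ultimately show "outer_row i \<le> outer_row j"
    by (auto simp: outer_row_def seq_append_def conj_row_mono add.assoc)
qed

lemma mono_on_inner_row: "mono_on {..<N} inner_row"
  by (rule mono_onI) (auto simp: inner_row_def seq_append_def)

lemma inner_row_le_outer_row: "inner_row i \<le> outer_row i"
  by (simp add: inner_row_def outer_row_def seq_append_def)

lemma beta_number_outer_row:
  "beta_number outer_row = (\<lambda>i. int (seq_append depth lower_beta upper_beta i))"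
  by (auto simp: fun_eq_iff beta_number_def outer_row_def seq_append_def lower_beta_def
      upper_beta_def not_less le_iff_add algebra_simps)

lemma beta_number_inner_row: "beta_number inner_row = (\<lambda>j. int (gap (depth + c) b j))"
  by (simp add: fun_eq_iff beta_number_def inner_row_def seq_append_def gap_def)

lemma num_syt_Lambda_shape_eq_aitken_det:
  "real (num_syt (Lambda_shape a b c d e m)) = fact (card (Lambda_shape a b c d e m)) *
    aitken_det (depth + (c + a)) (\<lambda>i. int (seq_append depth lower_beta upper_beta i))
      (\<lambda>j. int (gap (depth + c) b j))"
  unfolding Lambda_shape_eq_skew_cells
    num_syt_skew_cells[OF mono_on_outer_row mono_on_inner_row inner_row_le_outer_row]
  by (simp only: beta_number_outer_row beta_number_inner_row)

sublocale complementary_beta_numbers depth "b + c" lower_beta "\<lambda>t. (m + 1) * t"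
proof -
  have "complementary_beta_numbers depth (b + c)
      (\<lambda>i. conj_row (b + c) (\<lambda>t. t * m) i + i) (\<lambda>t. t * m + t)"
    by (rule complementary_beta_numbers_conj_row[OF mono_on_mult_m mult_m_le_depth])
  moreover have "(\<lambda>t. (m + 1) * t) = (\<lambda>t. t * m + t)" by (simp add: fun_eq_iff)
  ultimately show "complementary_beta_numbers depth (b + c) lower_beta (\<lambda>t. (m + 1) * t)"
    unfolding lower_beta_def[abs_def] by simp
qed

lemma depth_add_eq:
  assumes "t < b + c"
  shows "depth + (b + c) = 1 + e + (b + c - Suc t) * (m + 1) + (m + 1) * t"
proof -
  obtain u where u: "b + c = Suc t + u" using assms less_iff_Suc_add by auto
  show ?thesis unfolding depth_def u by (simp add: algebra_simps)
qed

lemma prod_fact_depth_minus_multiples: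
  "(\<Prod>t<b + c. fact (depth + (b + c) - 1 - (m + 1) * t)) =
    (\<Prod>i<b + c. fact (e + i * (m + 1)) :: real)"
proof -
  have "(\<Prod>t<b + c. fact (depth + (b + c) - 1 - (m + 1) * t)) =
      (\<Prod>t<b + c. fact (e + (b + c - Suc t) * (m + 1)) :: real)"
  proof (intro prod.cong refl)
    fix t assume "t \<in> {..<b + c}"
    then have "depth + (b + c) - 1 - (m + 1) * t = e + (b + c - Suc t) * (m + 1)"
      using depth_add_eq[of t] by simp
    then show "fact (depth + (b + c) - 1 - (m + 1) * t) =
        (fact (e + (b + c - Suc t) * (m + 1)) :: real)"
      by (simp only:)
  qed
  also have "\<dots> = (\<Prod>i<b + c. fact (e + i * (m + 1)))"
    by (rule prod.nat_diff_reindex)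
  finally show ?thesis .
qed

lemma newton_upper_beta:
  assumes "n \<le> b + c"
  shows "newton (\<lambda>t. real (m + 1) * real t) n (real (upper_beta i)) =
    (\<Prod>t<n. real (1 + d + e + (b + c - n + t + i) * (m + 1)))"
proof -
  have "real (upper_beta i) - real (m + 1) * real t =
      real (1 + d + e + (b + c - n + (n - Suc t) + i) * (m + 1))" if "t < n" for t
  proof -
    have "b + c - n + (n - Suc t) = b + c - Suc t" using assms that by simp
    moreover have "upper_beta i = 1 + d + e + (b + c - Suc t + i) * (m + 1) + (m + 1) * t"
      using depth_add_eq[of t] assms that
      unfolding upper_beta_def add_mult_distrib by linarith
    ultimately show ?thesis by (simp add: algebra_simps)
  qed
  then have "newton (\<lambda>t. real (m + 1) * real t) n (real (upper_beta i)) =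
      (\<Prod>t<n. real (1 + d + e + (b + c - n + (n - Suc t) + i) * (m + 1)))"
    by (simp add: newton_def)
  also have "\<dots> = (\<Prod>t<n. real (1 + d + e + (b + c - n + t + i) * (m + 1)))"
    by (rule prod.nat_diff_reindex)
  finally show ?thesis .
qed

lemma fdet_newton_upper_beta:
  "fdet (c + a) (\<lambda>i j. newton (\<lambda>t. real (m + 1) * real t) (gap c b j) (real (upper_beta i))) =
    (\<Prod>j<a + c. real (m + 1) ^ j) *
    (real (superfact (a + b + c) * superfact a * superfact b * superfact c) /
      real (superfact (a + b) * superfact (b + c))) *
    real (\<Prod>i<b. \<Prod>j<a. 1 + d + e + (c + i + j) * (m + 1))"
proof -
  have upper_beta: "real (upper_beta i) = real (depth + (b + c) + d) + real (m + 1) * real i" for i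
    by (simp add: upper_beta_def algebra_simps)
  have "(\<Prod>j<a. newton (\<lambda>t. real (m + 1) * real t) b (real (upper_beta j))) =
      real (\<Prod>i<b. \<Prod>j<a. 1 + d + e + (c + i + j) * (m + 1))"
    unfolding newton_upper_beta[OF le_add1] diff_add_inverse of_nat_prod by (rule prod.swap)
  moreover have "real (m + 1) \<noteq> 0" by simp
  note fdet_newton_progression[OF this, of c a b "real (depth + (b + c) + d)"]
  ultimately show ?thesis
    unfolding upper_beta[symmetric] prod_fact_eq_superfact_quotient[symmetric]
    unfolding times_divide_eq_right[symmetric] mult.assoc
    by (simp only: prod.distrib mult_ac add.commute[of c a])
qed

lemma aitken_det_Lambda_shape:
  "aitken_det (depth + (c + a)) (\<lambda>i. int (seq_append depth lower_beta upper_beta i))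
      (\<lambda>j. int (gap (depth + c) b j)) =
    (\<Prod>j<b + c. real (m + 1) ^ j) * real (superfact (b + c)) /
      (\<Prod>i<b + c. fact (e + i * (m + 1))) *
    (1 / ((\<Prod>i<a + c. fact (d + i * (m + 1))) *
      real (\<Prod>i<b + c. \<Prod>j<a + c. 1 + d + e + (i + j) * (m + 1)))) *
    ((\<Prod>j<a + c. real (m + 1) ^ j) *
      (real (superfact (a + b + c) * superfact a * superfact b * superfact c) /
        real (superfact (a + b) * superfact (b + c))) *
      real (\<Prod>i<b. \<Prod>j<a. 1 + d + e + (c + i + j) * (m + 1)))"
proof -
  have ge: "depth + (b + c) \<le> upper_beta i"
    and diff: "upper_beta i - (depth + (b + c)) = d + i * (m + 1)" for i
    by (simp_all add: upper_beta_def)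
  have "(\<Prod>i<c + a. newton (\<lambda>t. real (m + 1) * real t) (b + c) (real (upper_beta i))) =
      real (\<Prod>i<b + c. \<Prod>j<a + c. 1 + d + e + (i + j) * (m + 1))"
    unfolding newton_upper_beta[OF order_refl] diff_self_eq_0 add_0 of_nat_prod add.commute[of c a]
    by (rule prod.swap)
  then have rows: "(\<Prod>i<c + a. 1 / (fact (d + i * (m + 1)) *
        newton (\<lambda>t. real (m + 1) * real t) (b + c) (real (upper_beta i)))) =
      1 / ((\<Prod>i<a + c. fact (d + i * (m + 1))) *
        real (\<Prod>i<b + c. \<Prod>j<a + c. 1 + d + e + (i + j) * (m + 1)))"
    by (simp only: prod_dividef prod.distrib prod.neutral_const add.commute[of c a])
  have nodes: "vandermonde ((\<lambda>t. (m + 1) * t) ` {..<b + c}) =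
      (\<Prod>j<b + c. real (m + 1) ^ j) * real (superfact (b + c))"
    using vandermonde_progression[of "m + 1" "b + c"] by (simp only: superfact_eq) simp
  show ?thesis
    unfolding aitken_det_gap[OF refl ge] diff of_nat_mult nodes rows fdet_newton_upper_beta
      prod_fact_depth_minus_multiples ..
qed

end

theorem theorem4p1:
  fixes a b c d e m n :: nat and \<pi> :: "cell set"
  assumes "\<pi> = Lambda_shape a b c d e m"
    and "n = card \<pi>"
  shows "real (num_syt \<pi>) =
    fact n
    * (real (superfact (a + b + c) * superfact a * superfact b * superfact c)
       / real (superfact (a + b) * superfact (b + c) * superfact (a + c)
               * Psi m (a + c) * Psi m (b + c)))
    * (\<Prod>i<a + c. fact (i * (m + 1)) / fact (d + i * (m + 1)))
    * (\<Prod>i<b + c. fact (i * (m + 1)) / fact (e + i * (m + 1)))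
    * (real (\<Prod>i<b. \<Prod>j<a. 1 + d + e + (c + i + j) * (m + 1))
       / real (\<Prod>i<b + c. \<Prod>j<a + c. 1 + d + e + (i + j) * (m + 1)))"
proof -
  interpret Lambda_parameters a b c d e m .
  have "real (num_syt \<pi>) = fact n *
      aitken_det (depth + (c + a)) (\<lambda>i. int (seq_append depth lower_beta upper_beta i))
        (\<lambda>j. int (gap (depth + c) b j))"
    unfolding assms by (rule num_syt_Lambda_shape_eq_aitken_det)
  then show ?thesis
    unfolding aitken_det_Lambda_shape prod_dividef prod_fact_multiples of_nat_mult
    by (simp add: superfact_nonzero Psi_nonzero ac_simps del: of_nat_prod)
qed

end
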